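(* Let $\alpha\ge 2$ be any ordinal and let $m\ge 1$ be a finite cardinal. Then there is $x\in\mathfrak{Fr}_m\mathrm{CA}_{\alpha}$ such that $x\ne 0$ and $x\le -d_{ij}$ for all $i,j\in\alpha\setminus\{0,1\}$ with $i\ne j$.
   Context: A cylindric algebra of dimension $\alpha$ is an algebra $\langle A,+,\cdot,-,0,1,c_i,d_{ij}\rangle_{i,j\in\alpha}$ ($+,\cdot$ binary, $-,c_i$ unary, $0,1,d_{ij}$ constants) such that for all $x,y\in A$ and $i,j,k\in\alpha$: $\langle A,+,\cdot,-,0,1\rangle$ is a Boolean algebra; $c_i0=0$; $x+c_ix=c_ix$; $c_i(x\cdot c_iy)=c_ix\cdot c_iy$; $c_ic_jx=c_jc_ix$; $d_{ii}=1$; if $k\ne i,j$ then $d_{ij}=c_k(d_{ik}\cdot d_{kj})$; if $i\ne j$ then $c_i(d_{ij}\cdot x)\cdot c_i(d_{ij}\cdot -x)=0$. $\mathrm{CA}_{\alpha}$ is the class of these algebras, and $\mathfrak{Fr}_m\mathrm{CA}_{\alpha}$ is the free $\mathrm{CA}_{\alpha}$ on $m$ free generators. $\le$ is the Boolean order. *)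

theory Defs
  imports Main "HOL-Library.FuncSet"
begin

section \<open>Cylindric algebras\<close>

record ('a, 'i) cyl_alg =
  carr :: "'a set"
  join :: "'a \<Rightarrow> 'a \<Rightarrow> 'a"
  meet :: "'a \<Rightarrow> 'a \<Rightarrow> 'a"
  cmpl :: "'a \<Rightarrow> 'a"
  zer :: "'a"
  unt :: "'a"
  cyl :: "'i \<Rightarrow> 'a \<Rightarrow> 'a"
  diag :: "'i \<Rightarrow> 'i \<Rightarrow> 'a"

text \<open>
  Only the operations \<open>cyl A i\<close> and \<open>diag A i j\<close> with \<open>i, j \<in> I\<close> belong to an algebra of
  dimension \<open>I\<close>; the values at other indices are irrelevant.
\<close>

locale cyl_type_algebra =
  fixes I :: "'i set" and A :: "('a, 'i) cyl_alg"
  assumes join_closed: "\<lbrakk>x \<in> carr A; y \<in> carr A\<rbrakk> \<Longrightarrow> join A x y \<in> carr A"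
    and meet_closed: "\<lbrakk>x \<in> carr A; y \<in> carr A\<rbrakk> \<Longrightarrow> meet A x y \<in> carr A"
    and cmpl_closed: "x \<in> carr A \<Longrightarrow> cmpl A x \<in> carr A"
    and zer_closed: "zer A \<in> carr A"
    and unt_closed: "unt A \<in> carr A"
    and cyl_closed: "\<lbrakk>i \<in> I; x \<in> carr A\<rbrakk> \<Longrightarrow> cyl A i x \<in> carr A"
    and diag_closed: "\<lbrakk>i \<in> I; j \<in> I\<rbrakk> \<Longrightarrow> diag A i j \<in> carr A"

text \<open>
  The Boolean axioms are those of the library locale \<^locale>\<open>abstract_boolean_algebra\<close>,
  relativised to the carrier.
\<close>

locale cylindric_algebra = cyl_type_algebra I A
  for I :: "'i set" and A :: "('a, 'i) cyl_alg" +
  assumes join_assoc: "\<lbrakk>x \<in> carr A; y \<in> carr A; z \<in> carr A\<rbrakk> \<Longrightarrow>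
        join A (join A x y) z = join A x (join A y z)"
    and meet_assoc: "\<lbrakk>x \<in> carr A; y \<in> carr A; z \<in> carr A\<rbrakk> \<Longrightarrow>
        meet A (meet A x y) z = meet A x (meet A y z)"
    and join_commute: "\<lbrakk>x \<in> carr A; y \<in> carr A\<rbrakk> \<Longrightarrow> join A x y = join A y x"
    and meet_commute: "\<lbrakk>x \<in> carr A; y \<in> carr A\<rbrakk> \<Longrightarrow> meet A x y = meet A y x"
    and meet_join_distrib: "\<lbrakk>x \<in> carr A; y \<in> carr A; z \<in> carr A\<rbrakk> \<Longrightarrow>
        meet A x (join A y z) = join A (meet A x y) (meet A x z)"
    and join_meet_distrib: "\<lbrakk>x \<in> carr A; y \<in> carr A; z \<in> carr A\<rbrakk> \<Longrightarrow>
        join A x (meet A y z) = meet A (join A x y) (join A x z)"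
    and meet_unt: "x \<in> carr A \<Longrightarrow> meet A x (unt A) = x"
    and join_zer: "x \<in> carr A \<Longrightarrow> join A x (zer A) = x"
    and meet_cmpl: "x \<in> carr A \<Longrightarrow> meet A x (cmpl A x) = zer A"
    and join_cmpl: "x \<in> carr A \<Longrightarrow> join A x (cmpl A x) = unt A"
    and cyl_zer: "i \<in> I \<Longrightarrow> cyl A i (zer A) = zer A"
    and cyl_increasing: "\<lbrakk>i \<in> I; x \<in> carr A\<rbrakk> \<Longrightarrow> join A x (cyl A i x) = cyl A i x"
    and cyl_meet: "\<lbrakk>i \<in> I; x \<in> carr A; y \<in> carr A\<rbrakk> \<Longrightarrow>
        cyl A i (meet A x (cyl A i y)) = meet A (cyl A i x) (cyl A i y)"
    and cyl_commute: "\<lbrakk>i \<in> I; j \<in> I; x \<in> carr A\<rbrakk> \<Longrightarrow>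
        cyl A i (cyl A j x) = cyl A j (cyl A i x)"
    and diag_refl: "i \<in> I \<Longrightarrow> diag A i i = unt A"
    and diag_cyl: "\<lbrakk>i \<in> I; j \<in> I; k \<in> I; k \<noteq> i; k \<noteq> j\<rbrakk> \<Longrightarrow>
        diag A i j = cyl A k (meet A (diag A i k) (diag A k j))"
    and diag_subst: "\<lbrakk>i \<in> I; j \<in> I; i \<noteq> j; x \<in> carr A\<rbrakk> \<Longrightarrow>
        meet A (cyl A i (meet A (diag A i j) x))
               (cyl A i (meet A (diag A i j) (cmpl A x))) = zer A"

definition cyl_le :: "('a, 'i) cyl_alg \<Rightarrow> 'a \<Rightarrow> 'a \<Rightarrow> bool" where
  "cyl_le A x y \<longleftrightarrow> join A x y = y"


section \<open>Congruences and quotients\<close>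

definition cyl_congruence :: "'i set \<Rightarrow> ('a, 'i) cyl_alg \<Rightarrow> ('a \<times> 'a) set \<Rightarrow> bool" where
  "cyl_congruence I A R \<longleftrightarrow>
     equiv (carr A) R \<and>
     (\<forall>x x' y y'. (x, x') \<in> R \<longrightarrow> (y, y') \<in> R \<longrightarrow> (join A x y, join A x' y') \<in> R) \<and>
     (\<forall>x x' y y'. (x, x') \<in> R \<longrightarrow> (y, y') \<in> R \<longrightarrow> (meet A x y, meet A x' y') \<in> R) \<and>
     (\<forall>x x'. (x, x') \<in> R \<longrightarrow> (cmpl A x, cmpl A x') \<in> R) \<and>
     (\<forall>i\<in>I. \<forall>x x'. (x, x') \<in> R \<longrightarrow> (cyl A i x, cyl A i x') \<in> R)"

definition cyl_quot :: "('a, 'i) cyl_alg \<Rightarrow> ('a \<times> 'a) set \<Rightarrow> ('a set, 'i) cyl_alg" where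
  "cyl_quot A R =
     \<lparr>carr = carr A // R,
      join = (\<lambda>X Y. \<Union>x\<in>X. \<Union>y\<in>Y. R `` {join A x y}),
      meet = (\<lambda>X Y. \<Union>x\<in>X. \<Union>y\<in>Y. R `` {meet A x y}),
      cmpl = (\<lambda>X. \<Union>x\<in>X. R `` {cmpl A x}),
      zer = R `` {zer A},
      unt = R `` {unt A},
      cyl = (\<lambda>i X. \<Union>x\<in>X. R `` {cyl A i x}),
      diag = (\<lambda>i j. R `` {diag A i j})\<rparr>"


section \<open>Free cylindric algebras\<close>

datatype ('v, 'i) cyl_term =
    Gen 'v
  | Join "('v, 'i) cyl_term" "('v, 'i) cyl_term"
  | Meet "('v, 'i) cyl_term" "('v, 'i) cyl_term"
  | Cmpl "('v, 'i) cyl_term"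
  | Zer
  | Unt
  | Cyl 'i "('v, 'i) cyl_term"
  | Diag 'i 'i

inductive_set cyl_terms :: "'i set \<Rightarrow> 'v set \<Rightarrow> ('v, 'i) cyl_term set"
  for I :: "'i set" and V :: "'v set" where
    Gen: "v \<in> V \<Longrightarrow> Gen v \<in> cyl_terms I V"
  | Join: "\<lbrakk>s \<in> cyl_terms I V; t \<in> cyl_terms I V\<rbrakk> \<Longrightarrow> Join s t \<in> cyl_terms I V"
  | Meet: "\<lbrakk>s \<in> cyl_terms I V; t \<in> cyl_terms I V\<rbrakk> \<Longrightarrow> Meet s t \<in> cyl_terms I V"
  | Cmpl: "s \<in> cyl_terms I V \<Longrightarrow> Cmpl s \<in> cyl_terms I V"
  | Zer: "Zer \<in> cyl_terms I V"
  | Unt: "Unt \<in> cyl_terms I V"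
  | Cyl: "\<lbrakk>i \<in> I; s \<in> cyl_terms I V\<rbrakk> \<Longrightarrow> Cyl i s \<in> cyl_terms I V"
  | Diag: "\<lbrakk>i \<in> I; j \<in> I\<rbrakk> \<Longrightarrow> Diag i j \<in> cyl_terms I V"

definition term_alg :: "'i set \<Rightarrow> 'v set \<Rightarrow> (('v, 'i) cyl_term, 'i) cyl_alg" where
  "term_alg I V =
     \<lparr>carr = cyl_terms I V, join = Join, meet = Meet, cmpl = Cmpl,
      zer = Zer, unt = Unt, cyl = Cyl, diag = Diag\<rparr>"

text \<open>
  The free \<open>CA\<^bsub>I\<^esub>\<close> over \<open>V\<close>, constructed as in Henkin, Monk and Tarski: the absolutely free
  algebra (term algebra) over \<open>V\<close> modulo the intersection of all its congruences whose quotient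
  is a \<open>CA\<^bsub>I\<^esub>\<close>.  The universal property, for target algebras of arbitrary type, is
  \<open>free_CA_universal\<close> below.
\<close>

definition CA_cong :: "'i set \<Rightarrow> 'v set \<Rightarrow> (('v, 'i) cyl_term \<times> ('v, 'i) cyl_term) set" where
  "CA_cong I V =
     \<Inter> {R. cyl_congruence I (term_alg I V) R \<and> cylindric_algebra I (cyl_quot (term_alg I V) R)}"

definition free_CA :: "'i set \<Rightarrow> 'v set \<Rightarrow> (('v, 'i) cyl_term set, 'i) cyl_alg" where
  "free_CA I V = cyl_quot (term_alg I V) (CA_cong I V)"

definition free_gen :: "'i set \<Rightarrow> 'v set \<Rightarrow> 'v \<Rightarrow> ('v, 'i) cyl_term set" where
  "free_gen I V v = CA_cong I V `` {Gen v}"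

definition cyl_hom ::
    "'i set \<Rightarrow> ('a, 'i) cyl_alg \<Rightarrow> ('b, 'i) cyl_alg \<Rightarrow> ('a \<Rightarrow> 'b) \<Rightarrow> bool" where
  "cyl_hom I A B h \<longleftrightarrow>
     h \<in> carr A \<rightarrow> carr B \<and>
     (\<forall>x\<in>carr A. \<forall>y\<in>carr A. h (join A x y) = join B (h x) (h y)) \<and>
     (\<forall>x\<in>carr A. \<forall>y\<in>carr A. h (meet A x y) = meet B (h x) (h y)) \<and>
     (\<forall>x\<in>carr A. h (cmpl A x) = cmpl B (h x)) \<and>
     h (zer A) = zer B \<and> h (unt A) = unt B \<and>
     (\<forall>i\<in>I. \<forall>x\<in>carr A. h (cyl A i x) = cyl B i (h x)) \<and>
     (\<forall>i\<in>I. \<forall>j\<in>I. h (diag A i j) = diag B i j)"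

subsection \<open>Quotient algebras\<close>

lemma term_alg_simps [simp]:
  "carr (term_alg I V) = cyl_terms I V" "join (term_alg I V) = Join"
  "meet (term_alg I V) = Meet" "cmpl (term_alg I V) = Cmpl"
  "zer (term_alg I V) = Zer" "unt (term_alg I V) = Unt"
  "cyl (term_alg I V) = Cyl" "diag (term_alg I V) = Diag"
  by (simp_all add: term_alg_def)

lemma cyl_type_algebra_term_alg: "cyl_type_algebra I (term_alg I V)"
  by unfold_locales (auto intro: cyl_terms.intros)

lemma carr_quot [simp]: "carr (cyl_quot A R) = carr A // R"
  and zer_quot [simp]: "zer (cyl_quot A R) = R `` {zer A}"
  and unt_quot [simp]: "unt (cyl_quot A R) = R `` {unt A}"
  and diag_quot [simp]: "diag (cyl_quot A R) i j = R `` {diag A i j}"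
  by (simp_all add: cyl_quot_def)

context
  fixes I :: "'i set" and A :: "('a, 'i) cyl_alg" and R :: "('a \<times> 'a) set"
  assumes cong: "cyl_congruence I A R"
begin

lemma cong_equiv: "equiv (carr A) R"
  using cong by (simp add: cyl_congruence_def)

lemma class_eq_iff: "x \<in> carr A \<Longrightarrow> y \<in> carr A \<Longrightarrow> R `` {x} = R `` {y} \<longleftrightarrow> (x, y) \<in> R"
  using eq_equiv_class_iff[OF cong_equiv] .

lemma cmpl_quot: "x \<in> carr A \<Longrightarrow> cmpl (cyl_quot A R) (R `` {x}) = R `` {cmpl A x}"
  unfolding cyl_quot_def cyl_alg.simps
  by (rule UN_equiv_class[OF cong_equiv])
    (use cong in \<open>auto simp only: congruent_def cyl_congruence_def intro!: equiv_class_eq[OF cong_equiv]\<close>)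

lemma cyl_quot: "i \<in> I \<Longrightarrow> x \<in> carr A \<Longrightarrow> cyl (cyl_quot A R) i (R `` {x}) = R `` {cyl A i x}"
  unfolding cyl_quot_def cyl_alg.simps
  by (rule UN_equiv_class[OF cong_equiv])
    (use cong in \<open>auto simp only: congruent_def cyl_congruence_def intro!: equiv_class_eq[OF cong_equiv]\<close>)

lemma join_quot: "x \<in> carr A \<Longrightarrow> y \<in> carr A \<Longrightarrow>
    join (cyl_quot A R) (R `` {x}) (R `` {y}) = R `` {join A x y}"
  unfolding cyl_quot_def cyl_alg.simps
  by (rule UN_equiv_class2[OF cong_equiv cong_equiv])
    (use cong in \<open>auto simp only: congruent2_def cyl_congruence_def intro!: equiv_class_eq[OF cong_equiv]\<close>)

lemma meet_quot: "x \<in> carr A \<Longrightarrow> y \<in> carr A \<Longrightarrow>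
    meet (cyl_quot A R) (R `` {x}) (R `` {y}) = R `` {meet A x y}"
  unfolding cyl_quot_def cyl_alg.simps
  by (rule UN_equiv_class2[OF cong_equiv cong_equiv])
    (use cong in \<open>auto simp only: congruent2_def cyl_congruence_def intro!: equiv_class_eq[OF cong_equiv]\<close>)

lemmas quot_ops = join_quot meet_quot cmpl_quot cyl_quot

context
  assumes type_alg: "cyl_type_algebra I A"
begin

interpretation cyl_type_algebra I A by (fact type_alg)

lemmas closed = join_closed meet_closed cmpl_closed zer_closed unt_closed cyl_closed diag_closed

lemma cyl_type_algebra_quot: "cyl_type_algebra I (cyl_quot A R)"
  unfolding cyl_type_algebra_def
  by (auto simp: quot_ops closed elim!: quotientE intro!: quotientI)

lemma cyl_hom_quot_proj: "cyl_hom I A (cyl_quot A R) (\<lambda>x. R `` {x})"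
  unfolding cyl_hom_def by (auto simp: quot_ops closed intro!: quotientI)

lemma cyl_hom_quot_lift:
  assumes h: "cyl_hom I A B h" and resp: "\<And>x y. (x, y) \<in> R \<Longrightarrow> h x = h y"
  shows "\<exists>h'. cyl_hom I (cyl_quot A R) B h' \<and> (\<forall>x\<in>carr A. h' (R `` {x}) = h x)"
proof -
  define h' where "h' = (\<lambda>X. h (SOME x. x \<in> X))"
  have h': "h' (R `` {x}) = h x" if "x \<in> carr A" for x
  proof -
    have "x \<in> R `` {x}" using that by (rule equiv_class_self[OF cong_equiv])
    then have "(SOME y. y \<in> R `` {x}) \<in> R `` {x}" by (rule someI)
    then show ?thesis unfolding h'_def using resp by force
  qed
  have "cyl_hom I (cyl_quot A R) B h'"
    using h unfolding cyl_hom_def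
    by (auto simp: quot_ops closed h' Pi_iff elim!: quotientE)
  then show ?thesis using h' by blast
qed

end

end

text \<open>An algebra whose points are separated by homomorphisms into cylindric algebras is one.\<close>

lemma cylindric_algebra_separated:
  fixes B :: "('b, 'i) cyl_alg"
  assumes "cyl_type_algebra I B"
    and sep: "\<And>x y. \<lbrakk>x \<in> carr B; y \<in> carr B;
       \<And>(C :: ('c, 'i) cyl_alg) h. \<lbrakk>cylindric_algebra I C; cyl_hom I B C h; C \<in> K\<rbrakk> \<Longrightarrow> h x = h y\<rbrakk>
       \<Longrightarrow> x = y"
  shows "cylindric_algebra I B"
proof -
  interpret B: cyl_type_algebra I B by fact
  note closed = B.join_closed B.meet_closed B.cmpl_closed B.zer_closed B.unt_closed
    B.cyl_closed B.diag_closed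
  have hom: "x \<in> carr B \<Longrightarrow> h x \<in> carr C"
      "x \<in> carr B \<Longrightarrow> y \<in> carr B \<Longrightarrow> h (join B x y) = join C (h x) (h y)"
      "x \<in> carr B \<Longrightarrow> y \<in> carr B \<Longrightarrow> h (meet B x y) = meet C (h x) (h y)"
      "x \<in> carr B \<Longrightarrow> h (cmpl B x) = cmpl C (h x)"
      "h (zer B) = zer C" "h (unt B) = unt C"
      "i \<in> I \<Longrightarrow> x \<in> carr B \<Longrightarrow> h (cyl B i x) = cyl C i (h x)"
      "i \<in> I \<Longrightarrow> j \<in> I \<Longrightarrow> h (diag B i j) = diag C i j"
    if "cyl_hom I B C h" for h x y i j and C :: "('c, 'i) cyl_alg"
    using that by (auto simp: cyl_hom_def)
  note ax = cylindric_algebra.join_assoc cylindric_algebra.meet_assoc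
    cylindric_algebra.meet_join_distrib cylindric_algebra.join_meet_distrib
    cylindric_algebra.meet_unt cylindric_algebra.join_zer cylindric_algebra.meet_cmpl
    cylindric_algebra.join_cmpl cylindric_algebra.cyl_zer cylindric_algebra.cyl_increasing
    cylindric_algebra.cyl_meet cylindric_algebra.diag_refl
    cylindric_algebra.diag_cyl[symmetric] cylindric_algebra.diag_subst
  show ?thesis
    by (unfold_locales; rule sep)
      (simp_all add: closed hom ax,
       (auto intro: cylindric_algebra.join_commute cylindric_algebra.meet_commute
          cylindric_algebra.cyl_commute simp: hom)?)
qed


subsection \<open>The free algebra\<close>

lemma cyl_congruence_full: "cyl_type_algebra I A \<Longrightarrow> cyl_congruence I A (carr A \<times> carr A)"
  unfolding cyl_congruence_def cyl_type_algebra_def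
  by (auto intro!: equivI refl_onI symI transI)

lemma CA_cong_congruence: "cyl_congruence I (term_alg I V) (CA_cong I V)"
proof -
  let ?T = "term_alg I V"
  let ?full = "carr ?T \<times> carr ?T"
  let ?S = "{R. cyl_congruence I ?T R \<and> cylindric_algebra I (cyl_quot ?T R)}"
  have full: "cyl_congruence I ?T ?full"
    by (rule cyl_congruence_full[OF cyl_type_algebra_term_alg])
  have "cylindric_algebra I (cyl_quot ?T ?full)"
  proof (rule cylindric_algebra_separated)
    show "cyl_type_algebra I (cyl_quot ?T ?full)"
      by (rule cyl_type_algebra_quot[OF full cyl_type_algebra_term_alg])
  qed (auto elim!: quotientE)
  with full have S: "?full \<in> ?S" by simp
  have "cyl_congruence I ?T (\<Inter> ?S)"
  proof (subst cyl_congruence_def, intro conjI)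
    show "equiv (carr ?T) (\<Inter> ?S)"
    proof (rule equivI)
      show "\<Inter> ?S \<subseteq> carr ?T \<times> carr ?T" using S by blast
      show "refl_on (carr ?T) (\<Inter> ?S)"
        using cong_equiv by (fastforce simp: refl_on_def equiv_def)
      show "sym (\<Inter> ?S)" using cong_equiv by (fastforce simp: sym_def equiv_def)
      show "trans (\<Inter> ?S)" using cong_equiv unfolding trans_def equiv_def by blast
    qed
  qed (auto simp: cyl_congruence_def)
  then show ?thesis by (simp add: CA_cong_def)
qed

theorem cylindric_algebra_free_CA:
  fixes I :: "'i set" and V :: "'v set"
  shows "cylindric_algebra I (free_CA I V)"
proof -
  let ?T = "term_alg I V"
  note C = CA_cong_congruence[of I V] cyl_type_algebra_term_alg[of I V]
  have "x = y" if xy: "x \<in> carr (free_CA I V)" "y \<in> carr (free_CA I V)"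
    and hom: "\<And>(C :: (('v, 'i) cyl_term set, 'i) cyl_alg) h.
      \<lbrakk>cylindric_algebra I C; cyl_hom I (free_CA I V) C h; C \<in> UNIV\<rbrakk> \<Longrightarrow> h x = h y" for x y
  proof -
    obtain s t where s: "s \<in> carr ?T" "x = CA_cong I V `` {s}"
      and t: "t \<in> carr ?T" "y = CA_cong I V `` {t}"
      using xy by (auto simp: free_CA_def elim!: quotientE)
    have "(s, t) \<in> R" if R: "cyl_congruence I ?T R" "cylindric_algebra I (cyl_quot ?T R)" for R
    proof -
      have "R `` {u} = R `` {v}" if "(u, v) \<in> CA_cong I V" for u v
        using that R by (intro equiv_class_eq[OF cong_equiv[OF R(1)]]) (auto simp: CA_cong_def)
      then obtain h where h: "cyl_hom I (free_CA I V) (cyl_quot ?T R) h"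
        "\<And>u. u \<in> carr ?T \<Longrightarrow> h (CA_cong I V `` {u}) = R `` {u}"
        using cyl_hom_quot_lift[OF C cyl_hom_quot_proj[OF R(1) C(2)]]
        unfolding free_CA_def by blast
      then have "R `` {s} = R `` {t}"
        using hom[OF R(2) h(1)] s t by simp
      then show ?thesis using class_eq_iff[OF R(1) s(1) t(1)] by simp
    qed
    then have "(s, t) \<in> CA_cong I V" by (simp add: CA_cong_def)
    then show ?thesis using class_eq_iff[OF C(1) s(1) t(1)] s t by simp
  qed
  then show ?thesis
    using cylindric_algebra_separated[of I "free_CA I V" UNIV]
      cyl_type_algebra_quot[OF C] unfolding free_CA_def by blast
qed

primrec term_eval :: "('a, 'i) cyl_alg \<Rightarrow> ('v \<Rightarrow> 'a) \<Rightarrow> ('v, 'i) cyl_term \<Rightarrow> 'a" where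
  "term_eval A f (Gen v) = f v"
| "term_eval A f (Join s t) = join A (term_eval A f s) (term_eval A f t)"
| "term_eval A f (Meet s t) = meet A (term_eval A f s) (term_eval A f t)"
| "term_eval A f (Cmpl s) = cmpl A (term_eval A f s)"
| "term_eval A f Zer = zer A"
| "term_eval A f Unt = unt A"
| "term_eval A f (Cyl i s) = cyl A i (term_eval A f s)"
| "term_eval A f (Diag i j) = diag A i j"

lemma cyl_hom_term_eval:
  assumes "cyl_type_algebra I A" and "f \<in> V \<rightarrow> carr A"
  shows "cyl_hom I (term_alg I V) A (term_eval A f)"
proof -
  interpret cyl_type_algebra I A by fact
  have "term_eval A f t \<in> carr A" if "t \<in> cyl_terms I V" for t
    using that assms(2)
    by induction (auto intro: join_closed meet_closed cmpl_closed zer_closed unt_closed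
        cyl_closed diag_closed)
  then show ?thesis by (auto simp: cyl_hom_def)
qed

lemma CA_cong_sound:
  assumes A: "cylindric_algebra I A" and f: "f \<in> V \<rightarrow> carr A" and st: "(s, t) \<in> CA_cong I V"
  shows "term_eval A f s = term_eval A f t"
proof -
  let ?T = "term_alg I V"
  let ?e = "term_eval A f"
  have tA: "cyl_type_algebra I A" using A by (simp add: cylindric_algebra_def)
  note e = cyl_hom_term_eval[OF tA f] and T = cyl_type_algebra_term_alg[of I V]
  define R where "R = {(s, t). s \<in> cyl_terms I V \<and> t \<in> cyl_terms I V \<and> ?e s = ?e t}"
  have R: "cyl_congruence I ?T R"
    unfolding cyl_congruence_def R_def
    by (auto intro!: equivI refl_onI symI transI intro: cyl_terms.intros)
  obtain h where h: "cyl_hom I (cyl_quot ?T R) A h"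
    "\<And>u. u \<in> carr ?T \<Longrightarrow> h (R `` {u}) = ?e u"
    using cyl_hom_quot_lift[OF R T e] by (auto simp: R_def)
  have "cylindric_algebra I (cyl_quot ?T R)"
  proof (rule cylindric_algebra_separated[where K = "{A}"])
    show "cyl_type_algebra I (cyl_quot ?T R)" by (rule cyl_type_algebra_quot[OF R T])
    fix x y
    assume xy: "x \<in> carr (cyl_quot ?T R)" "y \<in> carr (cyl_quot ?T R)"
      and eq: "\<And>C k. \<lbrakk>cylindric_algebra I C; cyl_hom I (cyl_quot ?T R) C k; C \<in> {A}\<rbrakk> \<Longrightarrow> k x = k y"
    obtain u v where u: "u \<in> carr ?T" "x = R `` {u}" and v: "v \<in> carr ?T" "y = R `` {v}"
      using xy by (auto elim!: quotientE)
    have "?e u = ?e v" using eq[OF A h(1)] h(2) u v by simp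
    then have "(u, v) \<in> R" using u v by (simp add: R_def)
    then show "x = y" using class_eq_iff[OF R u(1) v(1)] u v by simp
  qed
  then have "(s, t) \<in> R" using st R by (auto simp: CA_cong_def)
  then show ?thesis by (simp add: R_def)
qed

theorem free_CA_universal:
  assumes A: "cylindric_algebra I A" and f: "f \<in> V \<rightarrow> carr A"
  shows "\<exists>h. cyl_hom I (free_CA I V) A h \<and> (\<forall>v\<in>V. h (free_gen I V v) = f v) \<and>
    (\<forall>h'. cyl_hom I (free_CA I V) A h' \<and> (\<forall>v\<in>V. h' (free_gen I V v) = f v) \<longrightarrow>
          (\<forall>x\<in>carr (free_CA I V). h' x = h x))"
proof -
  let ?T = "term_alg I V"
  let ?q = "\<lambda>t. CA_cong I V `` {t}"
  have tA: "cyl_type_algebra I A" using A by (simp add: cylindric_algebra_def)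
  note C = CA_cong_congruence[of I V] cyl_type_algebra_term_alg[of I V]
  obtain h where h: "cyl_hom I (free_CA I V) A h"
    "\<And>t. t \<in> carr ?T \<Longrightarrow> h (?q t) = term_eval A f t"
    using cyl_hom_quot_lift[OF C cyl_hom_term_eval[OF tA f] CA_cong_sound[OF A f]]
    unfolding free_CA_def by blast
  have uniq: "h' (?q t) = term_eval A f t"
    if h': "cyl_hom I (free_CA I V) A h'" "\<forall>v\<in>V. h' (free_gen I V v) = f v"
      and t: "t \<in> cyl_terms I V" for h' t
  proof -
    have q: "cyl_hom I ?T (free_CA I V) ?q"
      unfolding free_CA_def by (rule cyl_hom_quot_proj[OF C])
    have qc: "?q t \<in> carr (free_CA I V)" if "t \<in> cyl_terms I V" for t
      using q that by (auto simp: cyl_hom_def)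
    have qops: "s \<in> cyl_terms I V \<Longrightarrow> t \<in> cyl_terms I V \<Longrightarrow> ?q (Join s t) = join (free_CA I V) (?q s) (?q t)"
      "s \<in> cyl_terms I V \<Longrightarrow> t \<in> cyl_terms I V \<Longrightarrow> ?q (Meet s t) = meet (free_CA I V) (?q s) (?q t)"
      "s \<in> cyl_terms I V \<Longrightarrow> ?q (Cmpl s) = cmpl (free_CA I V) (?q s)"
      "?q Zer = zer (free_CA I V)" "?q Unt = unt (free_CA I V)"
      "i \<in> I \<Longrightarrow> s \<in> cyl_terms I V \<Longrightarrow> ?q (Cyl i s) = cyl (free_CA I V) i (?q s)"
      "i \<in> I \<Longrightarrow> j \<in> I \<Longrightarrow> ?q (Diag i j) = diag (free_CA I V) i j" for s t i j
      using q by (simp_all add: cyl_hom_def)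
    show ?thesis
      using t
    proof induction
      case (Gen v)
      then show ?case using h'(2) by (simp add: free_gen_def)
    qed (use h'(1) qc in \<open>simp_all add: qops cyl_hom_def\<close>)
  qed
  show ?thesis
  proof (intro exI[of _ h] conjI allI impI ballI)
    show "cyl_hom I (free_CA I V) A h" by (fact h)
    show "h (free_gen I V v) = f v" if "v \<in> V" for v
      using h(2)[of "Gen v"] that by (simp add: free_gen_def cyl_terms.Gen)
    fix h' x
    assume h': "cyl_hom I (free_CA I V) A h' \<and> (\<forall>v\<in>V. h' (free_gen I V v) = f v)"
      and "x \<in> carr (free_CA I V)"
    then obtain t where "t \<in> cyl_terms I V" "x = ?q t"
      by (auto simp: free_CA_def elim!: quotientE)
    then show "h' x = h x" using uniq h' h(2) by simp
  qed
qed


section \<open>Ordinals\<close>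

text \<open>
  An ordinal \<open>\<alpha>\<close> is represented by a well-order relation \<open>r\<close> of type \<open>\<alpha>\<close>, its elements being
  those of \<open>Field r\<close>.
\<close>

definition ord_zero :: "'i rel \<Rightarrow> 'i" where
  "ord_zero r = wo_rel.minim r (Field r)"

definition ord_one :: "'i rel \<Rightarrow> 'i" where
  "ord_one r = wo_rel.suc r {ord_zero r}"

end

theory Submission
  imports Defs
begin

text \<open>
  The witness is the element by which a generator \<open>g\<close> violates an instance of Henkin's equation
  (variables \<open>0\<close>, \<open>1\<close> only), that is, \<open>x = c\<^sub>1(g \<cdot> c\<^sub>0(c\<^sub>1g \<cdot> -g)) \<cdot> -c\<^sub>0(c\<^sub>1g \<cdot> -d\<^sub>0\<^sub>1)\<close>.
  With a third variable \<open>i\<close> the equation is provable for elements \<open>y = c\<^sub>iy\<close>: both factors speak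
  about the existence of two distinct points in the domain of \<open>y\<close>, which \<open>i\<close> allows us to
  express by an element independent of \<open>0\<close> and \<open>1\<close>.  Below \<open>d\<^sub>i\<^sub>j\<close> the generator coincides with
  the \<open>c\<^sub>i\<close>-closed element \<open>c\<^sub>i(d\<^sub>i\<^sub>j \<cdot> g)\<close>, and \<open>d\<^sub>i\<^sub>j\<close> is closed under \<open>c\<^sub>0\<close> and \<open>c\<^sub>1\<close>, so \<open>x \<cdot> d\<^sub>i\<^sub>j = 0\<close>.
  On the other hand \<open>x\<close> is nonzero in the algebra of sets of \<open>\<alpha>\<close>-sequences in which one
  injective sequence has been split into two copies and \<open>g\<close> is one of the copies.
\<close>

section \<open>Arithmetic of cylindric algebras\<close>

context cylindric_algebra
begin

lemmas closed = join_closed meet_closed cmpl_closed zer_closed unt_closed cyl_closed diag_closed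

section \<open>Boolean order\<close>

definition le :: "'a \<Rightarrow> 'a \<Rightarrow> bool" (infix "\<sqsubseteq>" 50) where
  "x \<sqsubseteq> y \<longleftrightarrow> meet A x y = x"

lemma meet_left_commute:
  "\<lbrakk>x \<in> carr A; y \<in> carr A; z \<in> carr A\<rbrakk> \<Longrightarrow> meet A x (meet A y z) = meet A y (meet A x z)"
  by (metis meet_assoc meet_commute)

lemmas meet_ac = meet_assoc meet_commute meet_left_commute

lemma meet_idem: "x \<in> carr A \<Longrightarrow> meet A x x = x"
  using meet_join_distrib[of x x "cmpl A x"]
  by (simp add: closed join_cmpl join_zer meet_cmpl meet_unt)

lemma meet_left_idem: "\<lbrakk>x \<in> carr A; y \<in> carr A\<rbrakk> \<Longrightarrow> meet A x (meet A x y) = meet A x y"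
  by (metis meet_assoc meet_idem)

lemma meet_zer: "x \<in> carr A \<Longrightarrow> meet A x (zer A) = zer A"
  using meet_assoc[of x x "cmpl A x"] by (simp add: closed meet_cmpl meet_idem)

lemma le_trans: "\<lbrakk>x \<sqsubseteq> y; y \<sqsubseteq> z; x \<in> carr A; y \<in> carr A; z \<in> carr A\<rbrakk> \<Longrightarrow> x \<sqsubseteq> z"
  unfolding le_def by (metis meet_assoc)

lemma le_antisym: "\<lbrakk>x \<sqsubseteq> y; y \<sqsubseteq> x; x \<in> carr A; y \<in> carr A\<rbrakk> \<Longrightarrow> x = y"
  unfolding le_def by (metis meet_commute)

lemma meet_le1: "\<lbrakk>x \<in> carr A; y \<in> carr A\<rbrakk> \<Longrightarrow> meet A x y \<sqsubseteq> x"
  by (simp add: le_def meet_ac closed meet_idem meet_left_idem)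

lemma meet_le2: "\<lbrakk>x \<in> carr A; y \<in> carr A\<rbrakk> \<Longrightarrow> meet A x y \<sqsubseteq> y"
  by (simp add: le_def meet_ac closed meet_idem meet_left_idem)

lemma le_meet: "\<lbrakk>x \<sqsubseteq> y; x \<sqsubseteq> z; x \<in> carr A; y \<in> carr A; z \<in> carr A\<rbrakk> \<Longrightarrow> x \<sqsubseteq> meet A y z"
  unfolding le_def by (metis meet_assoc)

lemma le_meet1: "\<lbrakk>x \<sqsubseteq> z; x \<in> carr A; y \<in> carr A; z \<in> carr A\<rbrakk> \<Longrightarrow> meet A x y \<sqsubseteq> z"
  by (meson le_trans meet_le1 meet_closed)

lemma le_meet2: "\<lbrakk>y \<sqsubseteq> z; x \<in> carr A; y \<in> carr A; z \<in> carr A\<rbrakk> \<Longrightarrow> meet A x y \<sqsubseteq> z"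
  by (meson le_trans meet_le2 meet_closed)

lemma zer_le: "x \<in> carr A \<Longrightarrow> zer A \<sqsubseteq> x"
  by (metis le_def meet_commute meet_zer zer_closed)

lemma le_zer: "\<lbrakk>x \<sqsubseteq> zer A; x \<in> carr A\<rbrakk> \<Longrightarrow> x = zer A"
  by (metis le_def meet_zer)

text \<open>Case distinction on \<open>y\<close>: it replaces reasoning about points when an
  inclusion is proved.\<close>

lemma le_split:
  assumes "meet A x y \<sqsubseteq> z" "meet A x (cmpl A y) \<sqsubseteq> z"
    "x \<in> carr A" "y \<in> carr A" "z \<in> carr A"
  shows "x \<sqsubseteq> z"
proof -
  have x: "x = join A (meet A x y) (meet A x (cmpl A y))"
    using assms meet_join_distrib[of x y "cmpl A y"] by (simp add: closed join_cmpl meet_unt)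
  have "meet A z x = join A (meet A z (meet A x y)) (meet A z (meet A x (cmpl A y)))"
    using assms by (subst x) (simp add: meet_join_distrib closed)
  also have "\<dots> = x"
    using assms x by (simp add: le_def meet_commute closed)
  finally show ?thesis using assms by (simp add: le_def meet_commute)
qed

lemma le_cmpl_iff:
  assumes "x \<in> carr A" "y \<in> carr A"
  shows "x \<sqsubseteq> cmpl A y \<longleftrightarrow> meet A x y = zer A"
proof
  assume "x \<sqsubseteq> cmpl A y"
  then have "meet A x y = meet A x (meet A y (cmpl A y))"
    using assms unfolding le_def by (metis cmpl_closed meet_assoc meet_commute)
  then show "meet A x y = zer A" using assms by (simp add: meet_cmpl meet_zer)
next
  assume "meet A x y = zer A"
  then show "x \<sqsubseteq> cmpl A y"
    using assms by (intro le_split[of x y]) (simp_all add: zer_le meet_le2 closed)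
qed

lemma le_iff_cmpl:
  assumes "x \<in> carr A" "y \<in> carr A"
  shows "x \<sqsubseteq> y \<longleftrightarrow> meet A x (cmpl A y) = zer A"
proof
  assume "x \<sqsubseteq> y"
  then show "meet A x (cmpl A y) = zer A"
    using assms unfolding le_def by (metis cmpl_closed meet_assoc meet_cmpl meet_zer)
next
  assume "meet A x (cmpl A y) = zer A"
  then show "x \<sqsubseteq> y"
    using assms by (intro le_split[of x y]) (simp_all add: zer_le meet_le2 closed)
qed

text \<open>Passes from the meet form of the order, in which the inclusions are derived, to the join
  form in which the theorem is stated.\<close>

lemma le_imp_cyl_le:
  assumes "x \<sqsubseteq> y" "x \<in> carr A" "y \<in> carr A"
  shows "cyl_le A x y"
proof -
  have "join A x y = join A (meet A y x) (meet A y (unt A))"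
    using assms by (simp add: le_def meet_commute meet_unt)
  also have "\<dots> = meet A y (join A x (unt A))"
    using assms by (simp add: meet_join_distrib closed)
  also have "join A x (unt A) = unt A"
    using assms join_meet_distrib[of x "cmpl A x" "unt A"]
    by (simp add: closed join_cmpl meet_unt meet_commute[of "unt A"])
  finally show ?thesis using assms by (simp add: cyl_le_def meet_unt)
qed

section \<open>Cylindrifications as closure operators\<close>

lemma le_cyl: "\<lbrakk>i \<in> I; x \<in> carr A\<rbrakk> \<Longrightarrow> x \<sqsubseteq> cyl A i x"
  using join_meet_distrib[of x "zer A" "cyl A i x"]
  by (simp add: le_def closed cyl_increasing join_zer meet_commute[of "zer A"] meet_zer)

lemma cyl_unt: "i \<in> I \<Longrightarrow> cyl A i (unt A) = unt A"
  by (metis cyl_closed le_cyl le_def meet_commute meet_unt unt_closed)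

lemma cyl_idem: "\<lbrakk>i \<in> I; x \<in> carr A\<rbrakk> \<Longrightarrow> cyl A i (cyl A i x) = cyl A i x"
  by (metis cyl_closed cyl_meet cyl_unt meet_commute meet_unt unt_closed)

lemma cyl_meet_fixed:
  "\<lbrakk>i \<in> I; x \<in> carr A; y \<in> carr A; cyl A i y = y\<rbrakk> \<Longrightarrow> cyl A i (meet A x y) = meet A (cyl A i x) y"
  by (metis cyl_meet)

lemma cyl_mono:
  assumes "x \<sqsubseteq> y" "i \<in> I" "x \<in> carr A" "y \<in> carr A"
  shows "cyl A i x \<sqsubseteq> cyl A i y"
proof -
  have "x \<sqsubseteq> cyl A i y"
    using assms by (meson le_trans le_cyl cyl_closed)
  then have "cyl A i x = cyl A i (meet A x (cyl A i y))"
    by (simp add: le_def)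
  then show ?thesis using assms by (simp add: le_def cyl_meet)
qed

lemma cyl_least:
  "\<lbrakk>x \<sqsubseteq> y; cyl A i y = y; i \<in> I; x \<in> carr A; y \<in> carr A\<rbrakk> \<Longrightarrow> cyl A i x \<sqsubseteq> y"
  by (metis cyl_mono)

lemma cyl_cmpl_fixed:
  assumes "cyl A i x = x" "i \<in> I" "x \<in> carr A"
  shows "cyl A i (cmpl A x) = cmpl A x"
proof (rule le_antisym)
  have "meet A (cyl A i (cmpl A x)) x = cyl A i (meet A (cmpl A x) x)"
    using assms by (simp add: cyl_meet_fixed closed)
  also have "\<dots> = zer A"
    using assms by (simp add: meet_commute meet_cmpl cyl_zer closed)
  finally show "cyl A i (cmpl A x) \<sqsubseteq> cmpl A x"
    using assms by (simp add: le_cmpl_iff closed)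
qed (use assms in \<open>simp_all add: le_cyl closed\<close>)

section \<open>Diagonal elements as an equality relation\<close>

lemma cyl_diag_fixed:
  assumes "i \<in> I" "j \<in> I" "k \<in> I" "k \<noteq> i" "k \<noteq> j"
  shows "cyl A k (diag A i j) = diag A i j"
  using assms diag_cyl[OF assms] by (metis cyl_idem meet_closed diag_closed)

lemma diag_trans:
  assumes "i \<in> I" "j \<in> I" "k \<in> I" "k \<noteq> i" "k \<noteq> j"
  shows "meet A (diag A i k) (diag A k j) \<sqsubseteq> diag A i j"
  using assms diag_cyl[OF assms] by (metis le_cyl meet_closed diag_closed)

text \<open>Since \<open>c_i(d_ji * d_ij) = d_jj = 1\<close>, the axiom \<open>diag_subst\<close>
  for \<open>d_ij\<close> and \<open>x = d_ji\<close> forces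
  \<open>c_i(d_ij * -d_ji) = 0\<close>.\<close>

lemma diag_sym_le:
  assumes "i \<in> I" "j \<in> I" "i \<noteq> j"
  shows "diag A i j \<sqsubseteq> diag A j i"
proof -
  have "cyl A i (meet A (diag A i j) (diag A j i)) = unt A"
    using diag_cyl[of j j i] assms by (simp add: diag_refl meet_commute closed)
  then have "cyl A i (meet A (diag A i j) (cmpl A (diag A j i))) = zer A"
    using diag_subst[of i j "diag A j i"] assms
    by (metis closed(2,3,5,6,7) meet_commute meet_unt)
  then have "meet A (diag A i j) (cmpl A (diag A j i)) = zer A"
    using assms by (metis le_cyl le_zer closed(2,3,7))
  then show ?thesis using assms by (simp add: le_iff_cmpl closed)
qed

lemma diag_sym: "\<lbrakk>i \<in> I; j \<in> I\<rbrakk> \<Longrightarrow> diag A i j = diag A j i"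
  by (cases "i = j") (auto intro: le_antisym diag_sym_le closed)

lemma cyl_diag_unt:
  assumes "i \<in> I" "j \<in> I" "i \<noteq> j"
  shows "cyl A j (diag A i j) = unt A"
  using diag_cyl[of i i j] assms by (simp add: diag_refl diag_sym[of j i] meet_idem closed)

text \<open>The part of the left side outside \<open>x\<close> lies below both factors of
  \<open>diag_subst\<close> and hence vanishes.\<close>

lemma diag_meet_subst:
  assumes "i \<in> I" "j \<in> I" "i \<noteq> j" "x \<in> carr A"
  shows "meet A (diag A i j) (cyl A i (meet A (diag A i j) x)) = meet A (diag A i j) x"
proof (rule le_antisym)
  let ?d = "diag A i j" and ?s = "cyl A i (meet A (diag A i j) x)"
  note c = closed assms
  have "meet A (meet A ?d ?s) (cmpl A x) \<sqsubseteq> cyl A i (meet A ?d (cmpl A x))"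
    using le_cyl[of i "meet A ?d (cmpl A x)"]
      meet_le2[of ?s "meet A ?d (cmpl A x)"]
    by (simp add: c meet_ac) (meson c le_trans)
  moreover have "meet A (meet A ?d ?s) (cmpl A x) \<sqsubseteq> ?s"
    using meet_le1[of ?s "meet A ?d (cmpl A x)"] by (simp add: c meet_ac)
  ultimately have "meet A (meet A ?d ?s) (cmpl A x) \<sqsubseteq> zer A"
    using le_meet diag_subst[OF assms] by (metis c(1-7) assms)
  then have "meet A (meet A ?d ?s) (cmpl A x) = zer A"
    by (simp add: le_zer c)
  then have "meet A ?d ?s \<sqsubseteq> x" by (simp add: le_iff_cmpl c)
  then show "meet A ?d ?s \<sqsubseteq> meet A ?d x" by (simp add: le_meet meet_le1 c)
  show "meet A ?d x \<sqsubseteq> meet A ?d ?s" by (simp add: le_meet le_cyl meet_le1 c)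
qed (use assms in \<open>simp_all add: closed\<close>)

end


section \<open>The Henkin element\<close>

text \<open>Read \<open>y\<close> as a binary relation between coordinates \<open>p\<close> and
  \<open>q\<close>, with domain \<open>c_q y\<close>. The first factor gives two domain points,
  since for one value of \<open>q\<close> the relation holds at one and fails at the other; the
  second says that every domain point equals coordinate \<open>q\<close>.\<close>

definition henkin :: "('a, 'i) cyl_alg \<Rightarrow> 'i \<Rightarrow> 'i \<Rightarrow> 'a \<Rightarrow> 'a" where
  "henkin A p q y =
     meet A (cyl A q (meet A y (cyl A p (meet A (cyl A q y) (cmpl A y)))))
       (cmpl A (cyl A p (meet A (cyl A q y) (cmpl A (diag A p q)))))"

context cylindric_algebra
begin

lemma henkin_closed: "\<lbrakk>p \<in> I; q \<in> I; y \<in> carr A\<rbrakk> \<Longrightarrow> henkin A p q y \<in> carr A"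
  by (simp add: henkin_def closed)

lemma henkin_eq_zer:
  assumes I: "p \<in> I" "q \<in> I" "i \<in> I" and ne: "p \<noteq> q" "i \<noteq> p" "i \<noteq> q"
    and a: "a \<in> carr A" "cyl A i a = a"
  shows "henkin A p q a = zer A"
proof -
  note c = closed I a(1)
  \<comment> \<open>With \<open>a\<close> read as a relation between \<open>p\<close> and
    \<open>q\<close>, \<open>b\<close> puts \<open>p\<close> in its domain, \<open>S\<close>
    substitutes \<open>i\<close> for \<open>p\<close>, \<open>z\<close> says that \<open>p\<close>
    and \<open>i\<close> are distinct domain points, and \<open>t\<close> that some domain point
    differs from \<open>q\<close>.\<close>
  define b where "b = cyl A q a"
  define S where "S = (\<lambda>x. cyl A p (meet A (diag A p i) x))"
  define e where "e = meet A b (cmpl A a)"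
  define z where "z = meet A (meet A b (S b)) (cmpl A (diag A p i))"
  define t where "t = cyl A p (meet A b (cmpl A (diag A p q)))"
  have S_cl: "S x \<in> carr A" if "x \<in> carr A" for x using that by (simp add: S_def c)
  have b: "b \<in> carr A" "cyl A q b = b" "cyl A i b = b"
    using a I by (simp_all add: b_def cyl_idem closed cyl_commute[of i q])
  have e: "e \<in> carr A" "cyl A i e = e" "e \<sqsubseteq> b" "e \<sqsubseteq> cmpl A a"
    using b a I by (simp_all add: e_def cyl_meet_fixed cyl_cmpl_fixed closed meet_le1 meet_le2)
  have z: "z \<in> carr A" using b S_cl by (simp add: z_def c)
  have t: "t \<in> carr A" "cyl A p t = t" using b by (simp_all add: t_def c cyl_idem)
  note c = c b(1) e(1) z t(1) S_cl

  have "cyl A i (meet A b (cmpl A (diag A p q))) = meet A b (cmpl A (diag A p q))"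
    using b I ne by (simp add: c cyl_meet_fixed cyl_cmpl_fixed cyl_diag_fixed)
  then have t_i: "cyl A i t = t"
    by (simp add: t_def c cyl_commute[of i p])
  have qz: "cyl A q z = z"
  proof -
    have "cyl A q (S b) = S b"
      using b I ne by (simp add: S_def cyl_commute[of q p] cyl_meet_fixed cyl_diag_fixed c)
    then show ?thesis
      using b I ne by (simp add: z_def c cyl_meet_fixed cyl_cmpl_fixed cyl_diag_fixed)
  qed

  \<comment> \<open>The domain point different from \<open>q\<close> is \<open>p\<close> off
    \<open>d_pq\<close> and \<open>i\<close> on \<open>d_pq\<close>. If all three coincide, the last
    factor of \<open>z\<close> is contradicted.\<close>
  have z_le: "z \<sqsubseteq> t"
  proof (rule le_split[of z "diag A p q"])
    show "meet A z (cmpl A (diag A p q)) \<sqsubseteq> t"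
    proof -
      have "meet A z (cmpl A (diag A p q)) \<sqsubseteq> meet A b (cmpl A (diag A p q))"
        by (intro le_meet meet_le2 le_meet1) (simp_all add: z_def c le_meet1 meet_le1)
      then show ?thesis
        unfolding t_def by (rule le_trans) (simp_all add: c le_cyl)
    qed
    show "meet A z (diag A p q) \<sqsubseteq> t"
    proof (rule le_split[of _ "diag A q i"])
      have "meet A (meet A z (diag A p q)) (diag A q i) \<sqsubseteq> meet A (diag A p q) (diag A q i)"
        by (intro le_meet meet_le2 le_meet1) (simp_all add: c meet_le2)
      then have "meet A (meet A z (diag A p q)) (diag A q i) \<sqsubseteq> diag A p i"
        by (rule le_trans) (use ne in \<open>simp_all add: c diag_trans\<close>)
      moreover have "meet A (meet A z (diag A p q)) (diag A q i) \<sqsubseteq> cmpl A (diag A p i)"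
        by (intro le_meet1) (simp_all add: z_def c meet_le2)
      ultimately have "meet A (meet A z (diag A p q)) (diag A q i)
          \<sqsubseteq> meet A (diag A p i) (cmpl A (diag A p i))"
        by (intro le_meet) (simp_all add: c)
      then show "meet A (meet A z (diag A p q)) (diag A q i) \<sqsubseteq> t"
        by (simp add: c meet_cmpl) (metis c le_zer zer_le)
    next
      have sub: "meet A (diag A p i) (cmpl A (diag A q i)) \<sqsubseteq> cmpl A (diag A p q)"
      proof -
        let ?u = "meet A (diag A p q) (diag A p i)"
        have "?u \<sqsubseteq> diag A q i"
          using diag_trans[of q i p] ne by (simp add: c diag_sym[of p q])
        then have "meet A ?u (cmpl A (diag A q i)) = zer A"
          using le_iff_cmpl by (simp add: c)
        then show ?thesis
          by (simp add: le_cmpl_iff c meet_ac)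
      qed
      have "meet A (meet A z (diag A p q)) (cmpl A (diag A q i))
          \<sqsubseteq> meet A (S b) (cmpl A (diag A q i))"
        by (intro le_meet meet_le2 le_meet1) (simp_all add: z_def c le_meet1 meet_le2)
      also have "meet A (S b) (cmpl A (diag A q i))
          = cyl A p (meet A (meet A (diag A p i) b) (cmpl A (diag A q i)))"
        using ne by (simp add: S_def c cyl_meet_fixed cyl_cmpl_fixed cyl_diag_fixed)
      finally have 1: "meet A (meet A z (diag A p q)) (cmpl A (diag A q i))
          \<sqsubseteq> cyl A p (meet A (meet A (diag A p i) b) (cmpl A (diag A q i)))" .
      have "meet A b (meet A (diag A p i) (cmpl A (diag A q i)))
          \<sqsubseteq> meet A b (cmpl A (diag A p q))"
        by (intro le_meet meet_le1 le_meet2 sub) (simp_all add: c)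
      then have "meet A (meet A (diag A p i) b) (cmpl A (diag A q i))
          \<sqsubseteq> meet A b (cmpl A (diag A p q))"
        by (simp add: c meet_ac)
      then have "cyl A p (meet A (meet A (diag A p i) b) (cmpl A (diag A q i))) \<sqsubseteq> t"
        unfolding t_def by (rule cyl_mono) (simp_all add: c)
      with 1 show "meet A (meet A z (diag A p q)) (cmpl A (diag A q i)) \<sqsubseteq> t"
        by (rule le_trans) (simp_all add: c)
    qed (simp_all add: c)
  qed (simp_all add: c)

  \<comment> \<open>Here \<open>a\<close> holds at \<open>p\<close> and fails at the domain point
    \<open>i\<close>, so the two are distinct.\<close>
  have "meet A a (S e) \<sqsubseteq> z"
    unfolding z_def
  proof (intro le_meet)
    show "meet A a (S e) \<sqsubseteq> b"
      by (rule le_meet1) (simp_all add: c b_def le_cyl)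
    show "meet A a (S e) \<sqsubseteq> S b"
      unfolding S_def
      by (intro le_meet2 cyl_mono le_meet meet_le1) (simp_all add: c e le_meet2)
    have "meet A (diag A p i) (S e) = meet A (diag A p i) e"
      using ne by (simp add: S_def c diag_meet_subst)
    then have "meet A (diag A p i) (S e) \<sqsubseteq> cmpl A a"
      by (simp add: c e le_meet2)
    then have "meet A (meet A (diag A p i) (S e)) a = zer A"
      by (simp add: c le_cmpl_iff)
    then show "meet A a (S e) \<sqsubseteq> cmpl A (diag A p i)"
      by (simp add: c le_cmpl_iff meet_ac)
  qed (simp_all add: c)
  then have "cyl A i (meet A a (S e)) \<sqsubseteq> cyl A i z"
    by (rule cyl_mono) (simp_all add: c)
  \<comment> \<open>Renaming of a bound variable: as \<open>a\<close> and \<open>e\<close> are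
    independent of \<open>i\<close>, quantifying \<open>i\<close> away turns \<open>S e\<close> into
    \<open>c_p e\<close>.\<close>
  moreover have "cyl A i (meet A a (S e)) = meet A a (cyl A p e)"
  proof -
    have "cyl A i (S e) = cyl A p (cyl A i (meet A (diag A p i) e))"
      by (simp add: S_def c cyl_commute)
    also have "\<dots> = cyl A p e"
      using e ne by (simp add: c cyl_meet_fixed cyl_diag_unt) (simp add: c meet_commute meet_unt)
    finally show ?thesis
      using a cyl_meet_fixed[of i "S e" a] by (simp add: c meet_commute)
  qed
  ultimately have "meet A a (cyl A p e) \<sqsubseteq> cyl A i z" by simp
  \<comment> \<open>The outer \<open>c_q\<close> of the first Henkin factor is absorbed, because
    \<open>z\<close> keeps its second point in coordinate \<open>i\<close> and is independent of
    \<open>q\<close>.\<close>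
  moreover have "cyl A q (cyl A i z) = cyl A i z"
    using qz by (simp add: c cyl_commute[of q i])
  ultimately have "cyl A q (meet A a (cyl A p e)) \<sqsubseteq> cyl A i z"
    by (rule cyl_least) (simp_all add: c)
  moreover have "cyl A i z \<sqsubseteq> t"
    using z_le t_i by (rule cyl_least) (simp_all add: c)
  ultimately have "cyl A q (meet A a (cyl A p e)) \<sqsubseteq> t"
    by (rule le_trans) (simp_all add: c)
  then show ?thesis
    using le_iff_cmpl by (simp add: henkin_def e_def b_def t_def c)
qed

section \<open>Agreement below an element \<open>d\<close>\<close>

lemma cmpl_meet_cong:
  assumes "meet A x d = meet A y d" "x \<in> carr A" "y \<in> carr A" "d \<in> carr A"
  shows "meet A (cmpl A x) d = meet A (cmpl A y) d"
proof -
  have *: "meet A (cmpl A u) d \<sqsubseteq> meet A (cmpl A v) d"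
    if "meet A u d = meet A v d" "u \<in> carr A" "v \<in> carr A" for u v
  proof (rule le_meet)
    have "meet A (meet A (cmpl A u) d) v = meet A (cmpl A u) (meet A v d)"
      using that(2,3) assms(4) by (simp add: closed meet_ac)
    also have "\<dots> = meet A (cmpl A u) (meet A u d)" by (simp add: that)
    also have "\<dots> = meet A d (meet A u (cmpl A u))" using that(2,3) assms(4) by (simp add: closed meet_ac)
    also have "\<dots> = zer A" using that assms by (simp add: meet_cmpl meet_zer)
    finally show "meet A (cmpl A u) d \<sqsubseteq> cmpl A v"
      using that assms by (simp add: le_cmpl_iff closed)
  qed (use that assms in \<open>simp_all add: closed meet_le2\<close>)
  show ?thesis
    by (rule le_antisym) (use * assms in \<open>simp_all add: closed\<close>)
qed

lemma meet_meet_cong: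
  assumes "meet A x d = meet A x' d" "meet A y d = meet A y' d"
    "x \<in> carr A" "x' \<in> carr A" "y \<in> carr A" "y' \<in> carr A" "d \<in> carr A"
  shows "meet A (meet A x y) d = meet A (meet A x' y') d"
proof -
  have "meet A (meet A u v) d = meet A (meet A u d) (meet A v d)"
    if "u \<in> carr A" "v \<in> carr A" for u v
    using that assms(7) by (simp add: closed meet_ac meet_left_idem)
  then show ?thesis using assms by simp
qed

lemma cyl_meet_cong:
  assumes "meet A x d = meet A y d" "cyl A k d = d" "k \<in> I"
    "x \<in> carr A" "y \<in> carr A" "d \<in> carr A"
  shows "meet A (cyl A k x) d = meet A (cyl A k y) d"
  using assms cyl_meet_fixed by metis

text \<open>Meets, complements and cylindrifications that fix \<open>d\<close> preserve agreement
  below \<open>d\<close>, and \<open>henkin\<close> applies nothing else to its argument.\<close>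

lemma henkin_cong:
  assumes "meet A x d = meet A y d" "cyl A p d = d" "cyl A q d = d" "p \<in> I" "q \<in> I"
    "x \<in> carr A" "y \<in> carr A" "d \<in> carr A"
  shows "meet A (henkin A p q x) d = meet A (henkin A p q y) d"
  unfolding henkin_def
  by (intro meet_meet_cong cmpl_meet_cong cyl_meet_cong) (use assms in \<open>simp_all add: closed\<close>)

lemma henkin_le_cmpl_diag:
  assumes I: "p \<in> I" "q \<in> I" "i \<in> I - {p, q}" "j \<in> I - {p, q}" and ne: "p \<noteq> q" "i \<noteq> j"
    and y: "y \<in> carr A"
  shows "cyl_le A (henkin A p q y) (cmpl A (diag A i j))"
proof -
  let ?d = "diag A i j"
  let ?s = "cyl A i (meet A ?d y)"
  have c: "?d \<in> carr A" "?s \<in> carr A" using I y by (simp_all add: closed)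
  have "meet A y ?d = meet A ?s ?d"
    using diag_meet_subst[of i j y] I ne y c by (simp add: meet_commute)
  then have "meet A (henkin A p q y) ?d = meet A (henkin A p q ?s) ?d"
    using I y c by (intro henkin_cong) (auto simp: cyl_diag_fixed)
  also have "henkin A p q ?s = zer A"
    using I ne y c by (intro henkin_eq_zer[where i = i]) (auto simp: cyl_idem closed)
  also have "meet A (zer A) ?d = zer A"
    using c by (simp add: meet_commute[of "zer A"] meet_zer closed)
  finally show ?thesis
    using I y c by (intro le_imp_cyl_le) (simp_all add: le_cmpl_iff henkin_closed closed)
qed

end

lemma cyl_hom_henkin:
  assumes h: "cyl_hom I A B h" and A: "cyl_type_algebra I A"
    and "p \<in> I" "q \<in> I" "y \<in> carr A"
  shows "h (henkin A p q y) = henkin B p q (h y)"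
proof -
  interpret cyl_type_algebra I A by fact
  show ?thesis
    using h assms(3-5) unfolding henkin_def cyl_hom_def
    by (simp add: meet_closed cmpl_closed cyl_closed diag_closed)
qed


section \<open>Splitting a sequence\<close>

text \<open>
  The identity is the sequence that occurs twice.  As it is injective, both copies lie outside all
  proper diagonals, so cylindrifications may ignore the tag without violating the axiom
  \<open>c\<^sub>i(d\<^sub>i\<^sub>j \<cdot> x) \<cdot> c\<^sub>i(d\<^sub>i\<^sub>j \<cdot> -x) = 0\<close>.
\<close>

definition split_points :: "(('i \<Rightarrow> 'i) \<times> bool) set" where
  "split_points = {(s, b). b \<longrightarrow> s = id}"

definition split_alg :: "((('i \<Rightarrow> 'i) \<times> bool) set, 'i) cyl_alg" where
  "split_alg =
     \<lparr>carr = Pow split_points, join = (\<union>), meet = (\<inter>), cmpl = (\<lambda>X. split_points - X),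
      zer = {}, unt = split_points,
      cyl = (\<lambda>i X. {(s, b) \<in> split_points. \<exists>u c. (s(i := u), c) \<in> X}),
      diag = (\<lambda>i j. {(s, b) \<in> split_points. s i = s j})\<rparr>"

text \<open>Every sequence has a copy tagged \<open>False\<close>, which serves as the intermediate
  point when two cylindrifications are exchanged.\<close>

lemma False_split_point: "(s, False) \<in> split_points"
  by (simp add: split_points_def)

lemma cylindric_algebra_split_alg: "cylindric_algebra I (split_alg :: (_, 'i) cyl_alg)"
proof -
  have cyl: "(s, b) \<in> cyl split_alg i X \<longleftrightarrow> (s, b) \<in> split_points \<and> (\<exists>u c. (s(i := u), c) \<in> X)"
    for s b X and i :: 'i
    by (simp add: split_alg_def)
  show ?thesis
  proof
    fix i j :: 'i and x
    show "cyl split_alg i (cyl split_alg j x) = cyl split_alg j (cyl split_alg i x)"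
    proof (cases "i = j")
      case False
      then show ?thesis
        by (auto simp: cyl False_split_point fun_upd_twist[of i j])
          (metis False_split_point fun_upd_twist)+
    qed simp
  next
    fix i j k :: 'i
    assume "k \<noteq> i" "k \<noteq> j"
    then show "diag split_alg i j
        = cyl split_alg k (meet split_alg (diag split_alg i k) (diag split_alg k j))"
      by (auto simp: split_alg_def split_points_def)
  next
    fix i j :: 'i and x
    assume "i \<noteq> j"
    \<comment> \<open>The witnesses for both factors have sequence \<open>s(i := s j)\<close>, which
      is not \<open>id\<close>. Their tags are therefore \<open>False\<close>, and one point would
      lie both inside and outside \<open>x\<close>.\<close>
    then have "s(i := s j) \<noteq> id" "id(i := j) \<noteq> id" for s
      by (metis fun_upd_apply id_apply)+
    with \<open>i \<noteq> j\<close> show "meet split_alg (cyl split_alg i (meet split_alg (diag split_alg i j) x))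
        (cyl split_alg i (meet split_alg (diag split_alg i j) (cmpl split_alg x))) = zer split_alg"
      by (auto simp: split_alg_def split_points_def)
  qed (auto simp: split_alg_def split_points_def, metis fun_upd_triv)
qed

lemma henkin_split_alg:
  assumes "p \<noteq> q"
  shows "henkin split_alg p q {(id, False)} \<noteq> {}"
proof -
  \<comment> \<open>Resetting \<open>q\<close> leads to \<open>(id, False)\<close>, whose twin
    \<open>(id, True)\<close> lies in \<open>c_q y\<close> but not in \<open>y\<close>; this gives
    the first factor with \<open>p\<close> unchanged. For the second, \<open>p\<close> is the only
    domain point, and it is the value at \<open>q\<close>.\<close>
  have "(id(q := p), False) \<in> henkin split_alg p q {(id, False)}"
    using assms unfolding henkin_def split_alg_def split_points_def
    by (auto simp: fun_eq_iff)
  then show ?thesis by blast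
qed


section \<open>The first two elements of an ordinal\<close>

lemma ord_zero_one:
  fixes r :: "'i rel"
  assumes "Well_order r" and "(natLeq_on 2, r) \<in> ordLeq"
  shows "ord_zero r \<in> Field r" "ord_one r \<in> Field r" "ord_zero r \<noteq> ord_one r"
proof -
  interpret wo_rel r using assms(1) by unfold_locales
  obtain f where f: "embed (natLeq_on 2) r f"
    using assms(2) by (auto simp: ordLeq_def)
  have "inj_on f (Field (natLeq_on 2))" "f ` Field (natLeq_on 2) \<subseteq> Field r"
    using embed_inj_on[OF natLeq_on_Well_order f] embed_Field[OF f] by blast+
  then have f01: "f 0 \<in> Field r" "f 1 \<in> Field r" "f 0 \<noteq> f 1"
    using inj_onD[of f "{x. x < 2}" 0 1] by (auto simp: Field_natLeq_on)
  then show z: "ord_zero r \<in> Field r"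
    unfolding ord_zero_def by (intro minim_in) auto
  have "(ord_zero r, x) \<in> r" if "x \<in> Field r" for x
    unfolding ord_zero_def using that by (intro minim_least) auto
  \<comment> \<open>One of \<open>f 0\<close> and \<open>f 1\<close> differs from the minimum, so
    the successor is taken of a set with strict upper bounds.\<close>
  then have "AboveS {ord_zero r} \<noteq> {}"
    using f01 by (auto simp: AboveS_def) metis
  then have "ord_one r \<in> AboveS {ord_zero r}"
    unfolding ord_one_def using z by (intro suc_AboveS) auto
  then show "ord_one r \<in> Field r" "ord_zero r \<noteq> ord_one r"
    by (auto simp: AboveS_def)
qed

theorem theorem1p3:
  fixes r :: "'i rel" and m :: nat
  assumes "Well_order r"
    and "(natLeq_on 2, r) \<in> ordLeq"
    and "1 \<le> m"
  shows "\<exists>x \<in> carr (free_CA (Field r) {..<m}).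
           x \<noteq> zer (free_CA (Field r) {..<m}) \<and>
           (\<forall>i \<in> Field r - {ord_zero r, ord_one r}. \<forall>j \<in> Field r - {ord_zero r, ord_one r}.
              i \<noteq> j \<longrightarrow>
              cyl_le (free_CA (Field r) {..<m}) x
                (cmpl (free_CA (Field r) {..<m}) (diag (free_CA (Field r) {..<m}) i j)))"
proof -
  let ?F = "free_CA (Field r) {..<m}" and ?p = "ord_zero r" and ?q = "ord_one r"
  \<comment> \<open>Generator \<open>0\<close> exists because \<open>1 \<le> m\<close>.\<close>
  let ?g = "free_gen (Field r) {..<m} 0"
  interpret F: cylindric_algebra "Field r" ?F by (rule cylindric_algebra_free_CA)
  note pq = ord_zero_one[OF assms(1,2)]
  have g: "?g \<in> carr ?F"
    using assms(3) by (auto simp: free_gen_def free_CA_def intro!: quotientI cyl_terms.Gen)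
  \<comment> \<open>All generators may go to the same copy; \<open>h\<close> then sends the Henkin
    element to a nonempty set and zero to the empty set.\<close>
  obtain h where h: "cyl_hom (Field r) ?F split_alg h" "h ?g = {(id, False)}"
    using free_CA_universal[OF cylindric_algebra_split_alg, of "\<lambda>_. {(id, False)}" "{..<m}" "Field r"]
      assms(3) by (auto simp: split_alg_def split_points_def)
  have "h (henkin ?F ?p ?q ?g) \<noteq> h (zer ?F)"
    using h pq g henkin_split_alg[OF pq(3)]
    by (simp add: cyl_hom_henkin[OF h(1) F.cyl_type_algebra_axioms] cyl_hom_def)
      (simp add: split_alg_def)
  then show ?thesis
    using pq g by (intro bexI[of _ "henkin ?F ?p ?q ?g"] conjI ballI impI
        F.henkin_le_cmpl_diag F.henkin_closed) auto
qed

end
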